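(* Let $s_1,s_2$ be distinct positive integers, and let $\delta_1,\delta_2\in(0,1/2]$. Set $\hat s_1=s_1/\gcd(s_1,s_2)$ and $\hat s_2=s_2/\gcd(s_1,s_2)$. Let $B_2(x)=x^2-x+\frac16$ be the second Bernoulli polynomial. Then $$\int_0^1\mathrm{safe}(s_1,\delta_1,t)\,\mathrm{safe}(s_2,\delta_2,t)\,dt=(1-2\delta_1)(1-2\delta_2)+\frac{B_2(\{\hat s_2\delta_1-\hat s_1\delta_2\})-B_2(\{\hat s_2\delta_1+\hat s_1\delta_2\})}{\hat s_1\hat s_2}.$$
   Context: For $x\in\mathbb{R}$, $\|x\|:=\min_{n\in\mathbb{Z}}|x-n|$ is the distance from $x$ to the nearest integer, and $\{x\}=x-\lfloor x\rfloor\in[0,1)$ is the fractional part of $x$. For a positive integer $s$, a real $t$, and $0<\delta<1/2$, the midpoint-valued safe function is $$\mathrm{safe}(s,\delta,t)=\begin{cases}1,&\text{if }\|st\|>\delta,\\ \tfrac12,&\text{if }\|st\|=\delta,\\ 0,&\text{if }\|st\|<\delta.\end{cases}$$ At the endpoint $\delta=1/2$, by convention, $\mathrm{safe}(s,1/2,t)=0$ for all $s$ and $t$. *)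

theory Defs
  imports "HOL-Analysis.Analysis"
begin

(* The infimum is a minimum, see dist_nearest_int_attained below. *)
definition dist_nearest_int :: "real \<Rightarrow> real" where
  "dist_nearest_int x = (INF n::int. \<bar>x - of_int n\<bar>)"

lemma dist_nearest_int_attained:
  "\<exists>n::int. dist_nearest_int x = \<bar>x - of_int n\<bar> \<and> (\<forall>m::int. \<bar>x - of_int n\<bar> \<le> \<bar>x - of_int m\<bar>)"
proof (intro exI conjI)
  have le: "\<bar>x - of_int (round x)\<bar> \<le> \<bar>x - of_int m\<bar>" for m :: int
    using round_diff_minimal[of x m] by simp
  show "\<forall>m::int. \<bar>x - of_int (round x)\<bar> \<le> \<bar>x - of_int m\<bar>"
    using le by blast
  show "dist_nearest_int x = \<bar>x - of_int (round x)\<bar>"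
    unfolding dist_nearest_int_def by (rule cInf_eq_minimum) (use le in auto)
qed

(* Only meaningful for s > 0 and 0 < d <= 1/2.  The value 0 at the endpoint d = 1/2 is a separate
   convention: the midpoint rule would give 1/2 at the points with distance exactly 1/2. *)
definition safe :: "nat \<Rightarrow> real \<Rightarrow> real \<Rightarrow> real" where
  "safe s d t =
     (if d = 1/2 then 0
      else if dist_nearest_int (real s * t) > d then 1
      else if dist_nearest_int (real s * t) = d then 1/2
      else 0)"

definition bernoulli_poly2 :: "real \<Rightarrow> real" where
  "bernoulli_poly2 x = x\<^sup>2 - x + 1/6"

end

theory Submission
  imports Defs "HOL-Number_Theory.Cong"
begin

text \<open>
  Write \<open>\<psi>(x) = {x} - 1/2\<close> for the sawtooth.  Away from the finitely many points of \<open>[0, 1]\<close> where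
  \<open>\<parallel>st\<parallel> = \<delta>\<close>, the safe function is
  \<open>1 - 2\<delta> + \<psi>(st + \<delta>) - \<psi>(st - \<delta>)\<close> (lemma \<open>safe_eq_sawtooth\<close>).  For
  \<open>\<delta> = 1/2\<close> the two sawtooth terms cancel, in accordance with the convention at that
  endpoint.  Expanding the product of two such expressions, the terms containing a single sawtooth
  integrate to \<open>0\<close>, and beyond the constant term there remains a signed sum of four correlations
  \<open>\<integral> \<psi>(s\<^sub>1 t + a) \<psi>(s\<^sub>2 t + b) dt\<close> with \<open>a = \<plusminus>\<delta>\<^sub>1\<close> and
  \<open>b = \<plusminus>\<delta>\<^sub>2\<close>.

  Each correlation equals \<open>B\<^sub>2({h\<^sub>2 a - h\<^sub>1 b}) / (2 h\<^sub>1 h\<^sub>2)\<close>, where the \<open>h\<^sub>i\<close> are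
  the \<open>s\<^sub>i\<close> divided by their gcd (lemma \<open>has_integral_sawtooth_correlation\<close>).  This is
  proved without Fourier series.  For coprime \<open>m\<close> and \<open>n\<close> the integral over a period does
  not change when \<open>t\<close> is translated by \<open>j/(mn)\<close>, so it may be averaged over
  \<open>0 \<le> j < mn\<close>.  The two factors are then shifted by \<open>j/n\<close> and \<open>j/m\<close>, hence depend
  only on \<open>j\<close> modulo \<open>n\<close> and modulo \<open>m\<close>; by the Chinese remainder theorem the sum over
  \<open>j\<close> becomes a product of two independent sums.  The distribution relation
  \<open>\<Sum>\<^sub>k \<psi>(x + k/n) = \<psi>(nx)\<close> evaluates both and leaves
  \<open>\<psi>(mnt + na) \<psi>(mnt + mb)\<close>, in which the two frequencies agree.  Rescaling \<open>t\<close> reduces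
  this to a polynomial integral over one period, which is where \<open>B\<^sub>2\<close> appears
  (lemma \<open>has_integral_sawtooth_product\<close>).  A common factor of \<open>s\<^sub>1\<close> and \<open>s\<^sub>2\<close> is
  removed by the same rescaling.
\<close>

section \<open>Integrals of periodic functions\<close>

lemma periodic_add_int:
  fixes h :: "real \<Rightarrow> real"
  assumes per: "\<And>x. h (x + 1) = h x"
  shows "h (x + of_int k) = h x"
proof (induction k rule: int_induct[where k = 0])
  case base
  then show ?case by simp
next
  case (step1 i)
  then show ?case using per[of "x + of_int i"] by (simp add: add.assoc)
next
  case (step2 i)
  then show ?case using per[of "x + of_int (i - 1)"] by (simp add: algebra_simps)
qed

text \<open>
  The interval \<open>[c, c + 1]\<close> is cut at \<open>\<lfloor>c\<rfloor> + 1\<close>, and both pieces are translated back to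
  \<open>[0, 1]\<close>, where they are complementary.
\<close>

lemma has_integral_periodic_unit_interval:
  fixes h :: "real \<Rightarrow> real"
  assumes per: "\<And>x. h (x + 1) = h x" and int: "(h has_integral I) {0..1}"
  shows "(h has_integral I) {c..c + 1}"
proof -
  define r where "r = frac c"
  have r: "0 \<le> r" "r \<le> 1"
    unfolding r_def using frac_lt_1[of c] by auto
  have c: "c = r + of_int \<lfloor>c\<rfloor>"
    by (simp add: r_def frac_def)
  have on: "h integrable_on {0..1}"
    using int by blast
  obtain A where A: "(h has_integral A) {0..r}"
    using integrable_subinterval_real[OF on, of 0 r] r by (auto simp: integrable_on_def)
  obtain B where B: "(h has_integral B) {r..1}"
    using integrable_subinterval_real[OF on, of r 1] r by (auto simp: integrable_on_def)
  have I: "I = A + B"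
    using has_integral_combine[OF r A B] int has_integral_unique by blast
  have move: "(h has_integral J) {a + of_int k..b + of_int k}"
    if "(h has_integral J) {a..b}" for J a b and k :: int
  proof -
    have "h \<circ> (+) (of_int k) = h"
      by (simp add: fun_eq_iff periodic_add_int[of h, OF per] add.commute)
    then show ?thesis
      using that by (simp flip: has_integral_shift_Icc_real)
  qed
  have "(h has_integral B) {c..1 + of_int \<lfloor>c\<rfloor>}"
    using move[OF B, of "\<lfloor>c\<rfloor>"] c by simp
  moreover have "(h has_integral A) {1 + of_int \<lfloor>c\<rfloor>..c + 1}"
    using move[OF A, of "\<lfloor>c\<rfloor> + 1"] c by (simp add: algebra_simps)
  ultimately have "(h has_integral (B + A)) {c..c + 1}"
    by (rule has_integral_combine[rotated 2]) linarith+
  then show ?thesis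
    by (simp add: I add.commute)
qed

text \<open>
  Substituting \<open>u = nt + c\<close> turns the integral into the mean over \<open>n\<close> consecutive periods.
  Every change of variables below, whether a translation (\<open>n = 1\<close>) or the removal of a common
  frequency, is an instance.
\<close>

lemma has_integral_periodic_scale_shift:
  fixes h :: "real \<Rightarrow> real" and n :: nat
  assumes per: "\<And>x. h (x + 1) = h x" and int: "(h has_integral I) {0..1}" and n: "n > 0"
  shows "((\<lambda>t. h (real n * t + c)) has_integral I) {0..1}"
proof -
  have many: "(h has_integral (real k * I)) {c..c + real k}" for k
  proof (induction k)
    case 0
    then show ?case using has_integral_refl(2)[of h c] by simp
  next
    case (Suc k)
    have "(h has_integral I) {c + real k..c + real k + 1}"
      by (rule has_integral_periodic_unit_interval[OF per int])
    with Suc have "(h has_integral (real k * I + I)) {c..c + real k + 1}"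
      by (intro has_integral_combine[of c "c + real k"]) auto
    then show ?case by (simp add: algebra_simps)
  qed
  have "((\<lambda>t. h (real n *\<^sub>R t + c)) has_integral (real n * I) /\<^sub>R real n ^ DIM(real))
          (cbox ((c - c) /\<^sub>R real n) ((c + real n - c) /\<^sub>R real n))"
    by (rule has_integral_affinity') (use many[of n] n in auto)
  then show ?thesis
    using n by (simp flip: mult.assoc)
qed

section \<open>The sawtooth and its distribution relation\<close>

definition sawtooth :: "real \<Rightarrow> real" where
  "sawtooth x = frac x - 1/2"

lemma sawtooth_add_1: "sawtooth (x + 1) = sawtooth x"
  by (simp add: sawtooth_def frac_1_eq)

lemma sawtooth_add_int: "sawtooth (x + of_int k) = sawtooth x"
  by (rule periodic_add_int[of sawtooth, OF sawtooth_add_1])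

lemma sawtooth_add_nat: "sawtooth (x + real k) = sawtooth x"
  using sawtooth_add_int[of x "int k"] by simp

lemma sum_periodic_complete_residues:
  fixes f :: "int \<Rightarrow> 'a::comm_monoid_add"
  assumes per: "\<And>i. f (i mod int n) = f i"
  shows "(\<Sum>k<n. f (j + int k)) = (\<Sum>k<n. f (int k))"
proof (cases "n = 0")
  case False
  have *: "(\<Sum>k<n. f (i + int k)) = (\<Sum>k\<in>{0..<int n}. f (i + k))" for i
    by (rule sum.reindex_bij_witness[of _ nat int]) auto
  have "(\<Sum>k\<in>{0..<int n}. f (j + k)) = (\<Sum>k\<in>{0..<int n}. f k)"
    by (rule sum.reindex_bij_witness[of _ "\<lambda>k. (k - j) mod int n" "\<lambda>k. (j + k) mod int n"])
       (use False in \<open>auto simp: mod_simps per\<close>)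
  then show ?thesis
    using *[of j] *[of 0] by simp
qed auto

text \<open>
  Write \<open>nx = j + \<theta>\<close> with \<open>j\<close> an integer and \<open>0 \<le> \<theta> < 1\<close>.  The fractional part of
  \<open>x + k/n = (j + k + \<theta>)/n\<close> is obtained by reducing \<open>j + k\<close> modulo \<open>n\<close>.  As \<open>k\<close> runs
  through a complete residue system so does \<open>j + k\<close>, so the sum does not depend on \<open>j\<close>.
\<close>

lemma sum_sawtooth_shifts:
  assumes n: "n > 0"
  shows "(\<Sum>k<n. sawtooth (x + real k / real n)) = sawtooth (real n * x)"
proof -
  define j where "j = \<lfloor>real n * x\<rfloor>"
  define \<theta> where "\<theta> = frac (real n * x)"
  have \<theta>: "0 \<le> \<theta>" "\<theta> < 1"
    by (simp_all add: \<theta>_def frac_lt_1)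
  have x: "x = (of_int j + \<theta>) / real n"
    using n by (simp add: j_def \<theta>_def frac_def)
  have frac_eq: "frac ((of_int i + \<theta>) / real n) = (of_int (i mod int n) + \<theta>) / real n" for i
  proof -
    have "i mod int n \<le> int n - 1"
      using pos_mod_bound[of "int n" i] n by linarith
    then have "of_int (i mod int n) \<le> real n - 1"
      by (metis of_int_1 of_int_diff of_int_le_iff of_int_of_nat_eq)
    then have "of_int (i mod int n) + \<theta> < real n"
      using \<theta> by linarith
    moreover have "0 \<le> real_of_int (i mod int n) + \<theta>"
      using n \<theta> by (intro add_nonneg_nonneg) auto
    moreover have "real_of_int i = of_int (i mod int n) + real n * of_int (i div int n)"
      by (metis add.commute mult_div_mod_eq of_int_add of_int_mult of_int_of_nat_eq)
    then have "(of_int i + \<theta>) / real n - (of_int (i mod int n) + \<theta>) / real n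
                 = of_int (i div int n)"
      using n by (simp add: field_simps)
    ultimately show ?thesis
      using n by (subst frac_unique_iff) auto
  qed
  have "(\<Sum>k<n. frac (x + real k / real n))
          = (\<Sum>k<n. frac ((of_int (j + int k) + \<theta>) / real n))"
    by (intro sum.cong refl arg_cong[of _ _ frac]) (simp add: x add_divide_distrib)
  also have "\<dots> = (\<Sum>k<n. frac ((of_int (int k) + \<theta>) / real n))"
    by (rule sum_periodic_complete_residues[of "\<lambda>i. frac ((of_int i + \<theta>) / real n)"])
       (simp add: frac_eq)
  also have "\<dots> = (\<Sum>k<n. (real k + \<theta>) / real n)"
    by (intro sum.cong refl) (simp only: frac_eq, simp)
  also have "\<dots> = (\<Sum>k<n. real k) / real n + \<theta>"
    using n by (simp add: add_divide_distrib sum.distrib sum_divide_distrib)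
  also have "(\<Sum>k<n. real k) = real n * (real n - 1) / 2"
    by (induction n) (auto simp: field_simps)
  finally have "(\<Sum>k<n. frac (x + real k / real n)) = (real n - 1) / 2 + \<theta>"
    using n by simp
  then show ?thesis
    by (simp add: sawtooth_def sum_subtractf \<theta>_def diff_divide_distrib)
qed

text \<open>
  By the Chinese remainder theorem the pair of residues of \<open>j\<close> takes each value exactly once
  for \<open>j < mn\<close>.
\<close>

lemma sum_mult_coprime_residues:
  fixes F G :: "nat \<Rightarrow> real" and m n :: nat
  assumes cop: "coprime m n" and m: "m > 0" and n: "n > 0"
    and F: "\<And>j. F (j mod n) = F j" and G: "\<And>j. G (j mod m) = G j"
  shows "(\<Sum>j<m * n. F j * G j) = (\<Sum>p<n. F p) * (\<Sum>q<m. G q)"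
proof -
  have bij: "bij_betw (\<lambda>j. (j mod n, j mod m)) {..<m * n} ({..<n} \<times> {..<m})"
    unfolding bij_betw_def
  proof (rule conjI)
    show inj: "inj_on (\<lambda>j. (j mod n, j mod m)) {..<m * n}"
    proof (rule inj_onI)
      fix i j assume ij: "i \<in> {..<m * n}" "j \<in> {..<m * n}"
        and eq: "(i mod n, i mod m) = (j mod n, j mod m)"
      have "[i = j] (mod m * n)"
        using eq cop by (intro coprime_cong_mult_nat) (simp_all add: cong_def)
      then show "i = j"
        using ij by (simp add: cong_less_modulus_unique_nat)
    qed
    have "(\<lambda>j. (j mod n, j mod m)) ` {..<m * n} \<subseteq> {..<n} \<times> {..<m}"
      using m n by auto
    then show "(\<lambda>j. (j mod n, j mod m)) ` {..<m * n} = {..<n} \<times> {..<m}"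
      by (rule card_subset_eq[rotated]) (simp_all add: card_image[OF inj] card_cartesian_product)
  qed
  have "(\<Sum>j<m * n. F j * G j) = (\<Sum>j<m * n. case (j mod n, j mod m) of (p, q) \<Rightarrow> F p * G q)"
    by (simp add: F G)
  also have "\<dots> = (\<Sum>(p, q)\<in>{..<n} \<times> {..<m}. F p * G q)"
    by (rule sum.reindex_bij_betw[OF bij])
  finally show ?thesis
    by (simp add: sum_product sum.cartesian_product)
qed

section \<open>Integrals of sawtooth products\<close>

text \<open>
  This is \<open>B\<^sub>2(1 - x) = B\<^sub>2(x)\<close>, extended periodically.
\<close>

lemma bernoulli_poly2_frac_uminus: "bernoulli_poly2 (frac (- x)) = bernoulli_poly2 (frac x)"
  by (cases "x \<in> \<int>") (auto simp: bernoulli_poly2_def frac_neg power2_eq_square algebra_simps)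

lemma has_integral_sawtooth_product_base:
  assumes c: "0 \<le> c" "c < 1"
  shows "((\<lambda>t. sawtooth t * sawtooth (t + c)) has_integral (bernoulli_poly2 c / 2)) {0..1}"
proof -
  \<comment> \<open>\<open>P e\<close> is an antiderivative of \<open>(t - 1/2) (t + e - 1/2)\<close>.  The product is this polynomial with
      \<open>e = c\<close> until \<open>t + c\<close> reaches \<open>1\<close>, and with \<open>e = c - 1\<close> from there on.\<close>
  define P where "P e x = x ^ 3 / 3 + (e - 1) * x\<^sup>2 / 2 - (e - 1/2) * x / 2" for e x :: real
  have poly: "((\<lambda>t. (t - 1/2) * (t + e - 1/2)) has_integral (P e y - P e x)) {x..y}"
    if "x \<le> y" for x y e :: real
    unfolding P_def
    by (rule fundamental_theorem_of_calculus[OF that])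
       (auto simp flip: has_real_derivative_iff_has_vector_derivative
         intro!: derivative_eq_intros simp: power2_eq_square field_simps)
  have low: "((\<lambda>t. sawtooth t * sawtooth (t + c)) has_integral (P c (1 - c) - P c 0)) {0..1 - c}"
  proof (rule has_integral_spike_finite[OF _ _ poly])
    show "sawtooth t * sawtooth (t + c) = (t - 1/2) * (t + c - 1/2)"
      if "t \<in> {0..1 - c} - {1 - c, 1}" for t
    proof -
      have "frac t = t" "frac (t + c) = t + c"
        using that c by (auto simp: frac_eq)
      then show ?thesis by (simp add: sawtooth_def)
    qed
  qed (use c in auto)
  have high: "((\<lambda>t. sawtooth t * sawtooth (t + c)) has_integral
      (P (c - 1) 1 - P (c - 1) (1 - c))) {1 - c..1}"
  proof (rule has_integral_spike_finite[OF _ _ poly])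
    show "sawtooth t * sawtooth (t + c) = (t - 1/2) * (t + (c - 1) - 1/2)"
      if "t \<in> {1 - c..1} - {1}" for t
    proof -
      have "frac t = t"
        using that c by (auto simp: frac_eq)
      moreover have "frac (t + c) = t + (c - 1)"
        using that c by (subst frac_unique_iff) auto
      ultimately show ?thesis by (simp add: sawtooth_def)
    qed
  qed (use c in auto)
  have "((\<lambda>t. sawtooth t * sawtooth (t + c)) has_integral
      (P c (1 - c) - P c 0 + (P (c - 1) 1 - P (c - 1) (1 - c)))) {0..1}"
    by (rule has_integral_combine[OF _ _ low high]) (use c in auto)
  moreover have "P c (1 - c) - P c 0 + (P (c - 1) 1 - P (c - 1) (1 - c)) = bernoulli_poly2 c / 2"
    by (simp add: P_def bernoulli_poly2_def power2_eq_square power3_eq_cube field_simps)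
  ultimately show ?thesis
    by simp
qed

text \<open>
  Translating by \<open>a\<close> moves the first factor to phase \<open>0\<close>; the phase difference matters only
  modulo \<open>1\<close>, and its sign is immaterial because \<open>B\<^sub>2({x})\<close> is even.
\<close>

lemma has_integral_sawtooth_product:
  "((\<lambda>t. sawtooth (t + a) * sawtooth (t + b)) has_integral
      (bernoulli_poly2 (frac (a - b)) / 2)) {0..1}"
proof -
  define c where "c = frac (b - a)"
  have "((\<lambda>t. sawtooth t * sawtooth (t + c)) has_integral (bernoulli_poly2 c / 2)) {0..1}"
    by (rule has_integral_sawtooth_product_base) (auto simp: c_def frac_lt_1)
  from has_integral_periodic_scale_shift[OF _ this, of 1 a]
  have "((\<lambda>t. sawtooth (t + a) * sawtooth (t + a + c)) has_integral (bernoulli_poly2 c / 2)) {0..1}"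
    using sawtooth_add_1 sawtooth_add_1[of "_ + c"] by (simp add: add.assoc add.commute add.left_commute)
  moreover have "sawtooth (t + a + c) = sawtooth (t + b)" for t
  proof -
    have "t + b = (t + a + c) + of_int \<lfloor>b - a\<rfloor>"
      by (simp add: c_def frac_def)
    then show ?thesis
      by (metis sawtooth_add_int)
  qed
  moreover have "bernoulli_poly2 c = bernoulli_poly2 (frac (a - b))"
    unfolding c_def using bernoulli_poly2_frac_uminus[of "a - b"] by simp
  ultimately show ?thesis by simp
qed

lemma has_integral_sawtooth_affine:
  assumes "s > 0"
  shows "((\<lambda>t. sawtooth (real s * t + a)) has_integral 0) {0..1}"
proof (rule has_integral_periodic_scale_shift[of sawtooth, OF sawtooth_add_1 _ assms])
  have "((\<lambda>t::real. t - 1/2) has_integral ((1\<^sup>2 / 2 - 1/2) - (0\<^sup>2 / 2 - 0 / 2))) {0..1}"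
    by (rule fundamental_theorem_of_calculus)
       (auto simp flip: has_real_derivative_iff_has_vector_derivative intro!: derivative_eq_intros)
  then have "((\<lambda>t::real. t - 1/2) has_integral 0) {0..1}" by simp
  then show "(sawtooth has_integral 0) {0..1}"
    by (rule has_integral_spike_finite[of "{1}", rotated 2]) (auto simp: sawtooth_def)
qed

text \<open>
  Averaging over translations relates integrals that are already known to exist, so integrability
  has to come from elsewhere: the product is bounded and Borel measurable.
\<close>

lemma integrable_sawtooth_product:
  "(\<lambda>t. sawtooth (p * t + a) * sawtooth (q * t + b)) integrable_on {0..1}"
proof (rule measurable_bounded_by_integrable_imp_integrable)
  have [measurable]: "sawtooth \<in> borel_measurable borel"
    unfolding sawtooth_def[abs_def] frac_def by measurable
  have "(\<lambda>t. sawtooth (p * t + a) * sawtooth (q * t + b)) \<in> borel_measurable borel"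
    by measurable
  then show "(\<lambda>t. sawtooth (p * t + a) * sawtooth (q * t + b)) \<in> borel_measurable (lebesgue_on {0..1})"
    by (intro measurable_restrict_space1 measurable_completion) simp
  show "(\<lambda>t. 1) integrable_on {0..1::real}" by auto
  have "\<bar>sawtooth x\<bar> \<le> 1" for x
    using frac_lt_1[of x] frac_ge_0[of x] unfolding sawtooth_def by arith
  then show "norm (sawtooth (p * t + a) * sawtooth (q * t + b)) \<le> 1" for t
    by (simp add: abs_mult mult_le_one)
qed auto

text \<open>
  Averaging over the \<open>mn\<close> translations by multiples of \<open>1/(mn)\<close> brings both factors to the
  common frequency \<open>mn\<close>; the number of translations is the source of the denominator.
\<close>

lemma has_integral_sawtooth_correlation_coprime:
  fixes m n :: nat
  assumes cop: "coprime m n" and m: "m > 0" and n: "n > 0"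
  shows "((\<lambda>t. sawtooth (real m * t + a) * sawtooth (real n * t + b)) has_integral
           (bernoulli_poly2 (frac (real n * a - real m * b)) / (2 * real m * real n))) {0..1}"
proof -
  define f where "f = (\<lambda>t. sawtooth (real m * t + a) * sawtooth (real n * t + b))"
  define I where "I = integral {0..1} f"
  have I: "(f has_integral I) {0..1}"
    unfolding I_def f_def using integrable_sawtooth_product by (rule integrable_integral)
  have per: "f (t + 1) = f t" for t
    using sawtooth_add_nat[of "real m * t + a" m] sawtooth_add_nat[of "real n * t + b" n]
    by (simp add: f_def algebra_simps)
  have shifted: "((\<lambda>t. f (t + real j / real (m * n))) has_integral I) {0..1}" for j
    using has_integral_periodic_scale_shift[OF per I, of 1 "real j / real (m * n)"] by simp
  have saw_mod: "sawtooth (x + real (j mod k) / real k) = sawtooth (x + real j / real k)"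
    if "k > 0" for x j k
  proof -
    have "real j = real (j mod k) + real k * real (j div k)"
      by (metis add.commute mult_div_mod_eq of_nat_add of_nat_mult)
    then have "x + real j / real k = x + real (j mod k) / real k + real (j div k)"
      using that by (simp add: field_simps)
    then show ?thesis
      by (simp only: sawtooth_add_nat)
  qed
  have split_shift: "f (t + real j / real (m * n))
      = sawtooth (real m * t + a + real j / real n) * sawtooth (real n * t + b + real j / real m)"
    for t j
  proof -
    have "real m * (t + real j / real (m * n)) + a = real m * t + a + real j / real n"
      "real n * (t + real j / real (m * n)) + b = real n * t + b + real j / real m"
      using m n by (simp_all add: distrib_left)
    then show ?thesis
      by (simp only: f_def)
  qed
  have sum: "(\<Sum>j<m * n. f (t + real j / real (m * n)))
     = sawtooth (real (m * n) * t + real n * a) * sawtooth (real (m * n) * t + real m * b)" for t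
  proof -
    have "(\<Sum>j<m * n. f (t + real j / real (m * n)))
        = (\<Sum>j<m * n. sawtooth (real m * t + a + real j / real n)
                      * sawtooth (real n * t + b + real j / real m))"
      by (simp only: split_shift)
    also have "\<dots> = (\<Sum>p<n. sawtooth (real m * t + a + real p / real n))
                    * (\<Sum>q<m. sawtooth (real n * t + b + real q / real m))"
      using m n by (intro sum_mult_coprime_residues[OF cop]) (auto simp: saw_mod)
    also have "\<dots> = sawtooth (real n * (real m * t + a)) * sawtooth (real m * (real n * t + b))"
      by (simp add: sum_sawtooth_shifts m n)
    finally show ?thesis
      by (simp add: algebra_simps)
  qed
  have "((\<lambda>t. \<Sum>j<m * n. f (t + real j / real (m * n))) has_integral (\<Sum>j<m * n. I)) {0..1}"
    by (intro has_integral_sum shifted) auto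
  then have A: "((\<lambda>t. sawtooth (real (m * n) * t + real n * a)
                     * sawtooth (real (m * n) * t + real m * b))
               has_integral (real (m * n) * I)) {0..1}"
    by (simp only: sum) simp
  have B: "((\<lambda>t. sawtooth (real (m * n) * t + 0 + real n * a) * sawtooth (real (m * n) * t + 0 + real m * b))
          has_integral (bernoulli_poly2 (frac (real n * a - real m * b)) / 2)) {0..1}"
    by (rule has_integral_periodic_scale_shift[OF _ has_integral_sawtooth_product])
       (use m n sawtooth_add_1[of "_ + real n * a"] sawtooth_add_1[of "_ + real m * b"]
         in \<open>auto simp: algebra_simps\<close>)
  have "real (m * n) * I = bernoulli_poly2 (frac (real n * a - real m * b)) / 2"
    using has_integral_unique[OF A] B by simp
  then have "I = bernoulli_poly2 (frac (real n * a - real m * b)) / (2 * real m * real n)"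
    using m n by (simp add: field_simps)
  then show ?thesis
    using I unfolding f_def by simp
qed

lemma has_integral_sawtooth_correlation:
  fixes s1 s2 :: nat
  assumes s1: "s1 > 0" and s2: "s2 > 0"
    and h1: "h1 = s1 div gcd s1 s2" and h2: "h2 = s2 div gcd s1 s2"
  shows "((\<lambda>t. sawtooth (real s1 * t + a) * sawtooth (real s2 * t + b)) has_integral
           (bernoulli_poly2 (frac (real h2 * a - real h1 * b)) / (2 * real h1 * real h2))) {0..1}"
proof -
  define g where "g = gcd s1 s2"
  have g: "g > 0" and s: "s1 = g * h1" "s2 = g * h2"
    using s1 by (simp_all add: g_def h1 h2)
  have h: "h1 > 0" "h2 > 0"
    using s s1 s2 by auto
  have cop: "coprime h1 h2"
    unfolding h1 h2 using s1 by (intro div_gcd_coprime) auto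
  define f where "f = (\<lambda>t. sawtooth (real h1 * t + a) * sawtooth (real h2 * t + b))"
  have per: "f (t + 1) = f t" for t
    using sawtooth_add_nat[of "real h1 * t + a" h1] sawtooth_add_nat[of "real h2 * t + b" h2]
    by (simp add: f_def algebra_simps)
  have "((\<lambda>t. f (real g * t + 0)) has_integral
         (bernoulli_poly2 (frac (real h2 * a - real h1 * b)) / (2 * real h1 * real h2))) {0..1}"
    unfolding f_def
    by (rule has_integral_periodic_scale_shift[OF _
          has_integral_sawtooth_correlation_coprime[OF cop h] g]) (use per in \<open>simp add: f_def\<close>)
  then show ?thesis
    by (simp add: f_def s mult.assoc mult.left_commute)
qed

section \<open>The safe function as a combination of sawtooths\<close>

lemma dist_nearest_int_eq_frac: "dist_nearest_int x = min (frac x) (1 - frac x)"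
proof (rule antisym)
  obtain k :: int where k: "dist_nearest_int x = \<bar>x - of_int k\<bar>"
    and le: "\<And>m::int. \<bar>x - of_int k\<bar> \<le> \<bar>x - of_int m\<bar>"
    using dist_nearest_int_attained by blast
  show "dist_nearest_int x \<le> min (frac x) (1 - frac x)"
    unfolding k using le[of "\<lfloor>x\<rfloor>"] le[of "\<lfloor>x\<rfloor> + 1"] frac_lt_1[of x] frac_ge_0[of x]
    by (simp add: frac_def)
  show "min (frac x) (1 - frac x) \<le> dist_nearest_int x"
  proof (cases "k \<le> \<lfloor>x\<rfloor>")
    case True
    then have "real_of_int k \<le> of_int \<lfloor>x\<rfloor>" by simp
    then show ?thesis unfolding k by (simp add: frac_def min_le_iff_disj) linarith
  next
    case False
    then have "real_of_int k \<ge> of_int \<lfloor>x\<rfloor> + 1" by linarith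
    then show ?thesis unfolding k by (simp add: frac_def min_le_iff_disj) linarith
  qed
qed

text \<open>
  With \<open>y = {st}\<close>, the difference \<open>{y + d} - {y - d}\<close> is \<open>2d\<close> as long as
  \<open>d < y < 1 - d\<close>.  It drops by \<open>1\<close> when \<open>y + d\<close> passes \<open>1\<close> or \<open>y - d\<close> becomes
  negative.  These two events exclude each other because \<open>d \<le> 1/2\<close>, and for \<open>d = 1/2\<close> one of
  them occurs for every \<open>y\<close>, which gives the constant value \<open>0\<close>.
\<close>

lemma safe_eq_sawtooth:
  assumes d: "d \<in> {0<..1/2}" and off: "dist_nearest_int (real s * t) \<noteq> d"
  shows "safe s d t = 1 - 2 * d + sawtooth (real s * t + d) - sawtooth (real s * t - d)"
proof -
  define y where "y = frac (real s * t)"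
  have y: "0 \<le> y" "y < 1"
    by (simp_all add: y_def frac_lt_1)
  have dist: "dist_nearest_int (real s * t) = min y (1 - y)"
    by (simp add: y_def dist_nearest_int_eq_frac)
  have shift: "sawtooth (real s * t + e) = sawtooth (y + e)" for e
  proof -
    have "real s * t + e = y + e + of_int \<lfloor>real s * t\<rfloor>"
      by (simp add: y_def frac_def)
    then show ?thesis
      by (metis sawtooth_add_int)
  qed
  have plus: "frac (y + d) = (if y + d < 1 then y + d else y + d - 1)"
    using y d by (subst frac_unique_iff) auto
  have minus: "frac (y - d) = (if y < d then y - d + 1 else y - d)"
    using y d by (subst frac_unique_iff) auto
  show ?thesis
    using y d off shift[of d] shift[of "- d"]
    by (auto simp: safe_def dist sawtooth_def plus minus min_def split: if_splits)
qed

lemma finite_dist_nearest_int_eq: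
  assumes s: "s > 0"
  shows "finite {t \<in> {0..1}. dist_nearest_int (real s * t) = d}"
proof -
  have "{t \<in> {0..1}. dist_nearest_int (real s * t) = d}
          \<subseteq> (\<lambda>(k, e). (of_int k + e) / real s) ` ({0..int s} \<times> {d, 1 - d})"
  proof
    fix t assume t: "t \<in> {t \<in> {0..1}. dist_nearest_int (real s * t) = d}"
    have "0 \<le> \<lfloor>real s * t\<rfloor>" "\<lfloor>real s * t\<rfloor> \<le> int s"
      using t s by (auto simp: floor_le_iff mult_left_le intro: le_less_trans[of _ "real s"])
    moreover have "frac (real s * t) \<in> {d, 1 - d}"
      using t by (auto simp: dist_nearest_int_eq_frac min_def split: if_splits)
    moreover have "t = (of_int \<lfloor>real s * t\<rfloor> + frac (real s * t)) / real s"
      using s by (simp add: frac_def)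
    ultimately show "t \<in> (\<lambda>(k, e). (of_int k + e) / real s) ` ({0..int s} \<times> {d, 1 - d})"
      by (intro image_eqI[of _ _ "(\<lfloor>real s * t\<rfloor>, frac (real s * t))"]) auto
  qed
  then show ?thesis
    by (rule finite_subset) auto
qed

section \<open>The correlation of two safe functions\<close>

text \<open>
  The four correlations coincide in pairs because \<open>B\<^sub>2({x})\<close> is even, which cancels the
  factor \<open>2\<close> in their denominators.
\<close>

theorem lemma4p1:
  fixes s1 s2 h1 h2 :: nat and d1 d2 :: real
  assumes "s1 > 0" and "s2 > 0" and "s1 \<noteq> s2"
    and "d1 \<in> {0<..1/2}" and "d2 \<in> {0<..1/2}"
    and "h1 = s1 div gcd s1 s2" and "h2 = s2 div gcd s1 s2"
  shows "((\<lambda>t. safe s1 d1 t * safe s2 d2 t) has_integral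
           ((1 - 2 * d1) * (1 - 2 * d2)
             + (bernoulli_poly2 (frac (real h2 * d1 - real h1 * d2))
                - bernoulli_poly2 (frac (real h2 * d1 + real h1 * d2)))
               / (real h1 * real h2))) {0..1}"
proof -
  define E1 where "E1 = 1 - 2 * d1"
  define E2 where "E2 = 1 - 2 * d2"
  define S where "S = (\<lambda>s a t. sawtooth (real s * t + a))"
  define C where "C = (\<lambda>a b. bernoulli_poly2 (frac (real h2 * a - real h1 * b)) / (2 * real h1 * real h2))"
  have corr: "((\<lambda>t. S s1 a t * S s2 b t) has_integral C a b) {0..1}" for a b
    unfolding S_def C_def by (rule has_integral_sawtooth_correlation) (use assms in auto)
  have mean: "((\<lambda>t. S s1 a t) has_integral 0) {0..1}" "((\<lambda>t. S s2 a t) has_integral 0) {0..1}" for a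
    unfolding S_def using assms by (auto intro: has_integral_sawtooth_affine)
  have const: "((\<lambda>t. E1 * E2) has_integral E1 * E2) {0..1::real}"
    using has_integral_const_real[of "E1 * E2" 0 1] by simp
  have "((\<lambda>t. E1 * E2 + E2 * (S s1 d1 t - S s1 (- d1) t) + E1 * (S s2 d2 t - S s2 (- d2) t)
           + ((S s1 d1 t * S s2 d2 t + S s1 (- d1) t * S s2 (- d2) t)
              - (S s1 d1 t * S s2 (- d2) t + S s1 (- d1) t * S s2 d2 t)))
        has_integral
          (E1 * E2 + E2 * (0 - 0) + E1 * (0 - 0)
           + ((C d1 d2 + C (- d1) (- d2)) - (C d1 (- d2) + C (- d1) d2)))) {0..1}"
    by (intro has_integral_add has_integral_diff has_integral_mult_right const mean corr)
  moreover have "C (- d1) (- d2) = C d1 d2" "C (- d1) d2 = C d1 (- d2)"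
    using bernoulli_poly2_frac_uminus[of "real h2 * d1 - real h1 * d2"]
      bernoulli_poly2_frac_uminus[of "real h2 * d1 + real h1 * d2"]
    by (simp_all add: C_def)
  ultimately have "((\<lambda>t. (E1 + S s1 d1 t - S s1 (- d1) t) * (E2 + S s2 d2 t - S s2 (- d2) t))
        has_integral (E1 * E2 + 2 * (C d1 d2 - C d1 (- d2)))) {0..1}"
    by (simp add: algebra_simps)
  then have "((\<lambda>t. safe s1 d1 t * safe s2 d2 t) has_integral (E1 * E2 + 2 * (C d1 d2 - C d1 (- d2)))) {0..1}"
  proof (rule has_integral_spike_finite[rotated 2])
    show "finite ({t \<in> {0..1}. dist_nearest_int (real s1 * t) = d1}
                  \<union> {t \<in> {0..1}. dist_nearest_int (real s2 * t) = d2})"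
      using finite_dist_nearest_int_eq assms(1,2) by (intro finite_UnI)
    show "safe s1 d1 t * safe s2 d2 t
        = (E1 + S s1 d1 t - S s1 (- d1) t) * (E2 + S s2 d2 t - S s2 (- d2) t)"
      if "t \<in> {0..1} - ({t \<in> {0..1}. dist_nearest_int (real s1 * t) = d1}
                  \<union> {t \<in> {0..1}. dist_nearest_int (real s2 * t) = d2})" for t
      using that assms safe_eq_sawtooth[of d1 s1 t] safe_eq_sawtooth[of d2 s2 t]
      by (simp add: E1_def E2_def S_def)
  qed
  moreover have "2 * (C d1 d2 - C d1 (- d2)) = (bernoulli_poly2 (frac (real h2 * d1 - real h1 * d2))
                - bernoulli_poly2 (frac (real h2 * d1 + real h1 * d2))) / (real h1 * real h2)"
    by (simp add: C_def diff_divide_distrib)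
  ultimately show ?thesis
    by (simp add: E1_def E2_def)
qed

end
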